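(* Let $c > 0$ be real, let $t \ge 2$ be a fixed integer, and for real $s > 0$ let $P_{s,t,c} = \{(x,y) : x \in [0,s],\ y \in \{c, 2c, \dots, tc\}\} \subseteq \mathbb{R}^2$. For all $s > 0$, $\operatorname{opx}(n, P_{s,t,c}) = O(s^{\frac1t} n^{2-\frac1t})$ as $n \to \infty$, where the implied multiplicative constant depends only on $t$ and $c$.
   Context: Containment for subsets of the plane: for $P, S \subseteq \mathbb{R}^2$, let $X_P, Y_P$ be the sets of $x$-coordinates and $y$-coordinates of points of $P$, and $X_S, Y_S$ likewise for $S$. $S$ contains $P$ if there exist functions $f_X: X_P \to X_S$ and $f_Y: Y_P \to Y_S$ such that (1) $\frac{f_X(x_0)-f_X(x_1)}{x_0-x_1} \ge 1$ for all $x_0 > x_1$ in $X_P$; (2) $\frac{f_Y(y_0)-f_Y(y_1)}{y_0-y_1} \ge 1$ for all $y_0 > y_1$ in $Y_P$; (3) $(f_X(x), f_Y(y)) \in S$ for all $(x,y) \in P$. Otherwise $S$ is $P$-free. For real $n > 0$, $\operatorname{opx}(n,P)$ is the supremum of the Lebesgue measure $\mu_2(S)$ over all open (in $\mathbb{R}^2$) $P$-free subsets $S \subseteq [0,n]^2$. $f(n) = O(g(n))$ means there is a constant $C > 0$ with $f(n) \le C g(n)$ for all sufficiently large $n$. Here $n$ ranges over positive reals, $C$ depends only on $t$ and $c$, and the threshold for "sufficiently large" may depend on $s$, $t$ and $c$. *)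

theory Defs
  imports "HOL-Analysis.Analysis"
begin

text \<open>Containment of \<open>P\<close> in \<open>S\<close>. Only the values of \<open>fX\<close> on \<open>X\<^sub>P = fst ` P\<close> and of \<open>fY\<close> on
  \<open>Y\<^sub>P = snd ` P\<close> matter, so total functions stand for functions on these sets.\<close>

definition plane_contains :: "(real \<times> real) set \<Rightarrow> (real \<times> real) set \<Rightarrow> bool" where
  "plane_contains S P \<longleftrightarrow>
     (\<exists>fX \<in> fst ` P \<rightarrow> fst ` S. \<exists>fY \<in> snd ` P \<rightarrow> snd ` S.
        (\<forall>x0 \<in> fst ` P. \<forall>x1 \<in> fst ` P. x0 > x1 \<longrightarrow> (fX x0 - fX x1) / (x0 - x1) \<ge> 1) \<and>
        (\<forall>y0 \<in> snd ` P. \<forall>y1 \<in> snd ` P. y0 > y1 \<longrightarrow> (fY y0 - fY y1) / (y0 - y1) \<ge> 1) \<and>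
        (\<forall>(x, y) \<in> P. (fX x, fY y) \<in> S))"

definition plane_free :: "(real \<times> real) set \<Rightarrow> (real \<times> real) set \<Rightarrow> bool" where
  "plane_free P S \<longleftrightarrow> \<not> plane_contains S P"

text \<open>The supremum is taken in \<^typ>\<open>ennreal\<close>, so that it is also meaningful (namely \<open>0\<close>) when no
  \<open>P\<close>-free set exists, which happens only for empty \<open>P\<close>.\<close>

definition opx :: "real \<Rightarrow> (real \<times> real) set \<Rightarrow> ennreal" where
  "opx n P = (SUP S \<in> {S. open S \<and> S \<subseteq> {0..n} \<times> {0..n} \<and> plane_free P S}. emeasure lebesgue S)"

definition segment_pattern :: "real \<Rightarrow> nat \<Rightarrow> real \<Rightarrow> (real \<times> real) set" where
  "segment_pattern s t c = {0..s} \<times> (\<lambda>k. real k * c) ` {1..t}"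

end

theory Submission
  imports Defs
begin

text \<open>
  A set \<open>A\<close> of reals of measure greater than \<open>s\<close> admits a map \<open>f\<close> from \<open>[0, s]\<close> with slopes at least 1,
  namely a shifted quantile function of the measure on a compact subset of \<open>A\<close>. Hence if \<open>S\<close> is
  \<open>P\<close>-free, any \<open>t\<close> horizontal slices of \<open>S\<close> at heights at least \<open>c\<close> apart meet in a set of measure
  at most \<open>s\<close>. For the \<open>N \<approx> n / c\<close> slices at heights \<open>y + k c\<close>, a continuous
  Kovari-Sos-Turan count then bounds the sum of their measures by
  \<open>O(n + N n (s / n) powr (1 / t))\<close>; integrating over one period of \<open>y\<close> gives the area of \<open>S\<close>.
\<close>

section \<open>Expanding maps into sets of large measure\<close>

text \<open>The distribution function of Lebesgue measure on a subset of \<open>A\<close> is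
  1-Lipschitz, so every right inverse of it expands distances.\<close>

lemma expanding_map_exists:
  fixes A :: "real set"
  assumes A: "A \<in> sets lebesgue" "bounded A"
    and s: "0 \<le> s" "ennreal s < emeasure lebesgue A"
  obtains f where "\<And>u. u \<in> {0..s} \<Longrightarrow> f u \<in> A"
    and "\<And>u v. u \<in> {0..s} \<Longrightarrow> v \<in> {0..s} \<Longrightarrow> u < v \<Longrightarrow> v - u \<le> f v - f u"
proof -
  have Alm: "A \<in> lmeasurable"
    using A by (simp add: bounded_set_imp_lmeasurable)
  have sA: "s < measure lebesgue A"
    using s Alm by (simp add: emeasure_eq_measure2 ennreal_less_iff)
  \<comment> \<open>Inner regularity: in a compact \<open>K\<close> of measure still above
    \<open>s\<close>, suprema are attained, so quantiles can be chosen inside the set.\<close>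
  obtain K where K: "closed K" "K \<subseteq> A" "A - K \<in> lmeasurable"
      "emeasure lebesgue (A - K) < ennreal (measure lebesgue A - s)"
    using sets_lebesgue_inner_closed[OF A(1), of "measure lebesgue A - s"] sA by auto
  have cK: "compact K"
    using K A(2) bounded_subset compact_eq_bounded_closed by blast
  have Klm: "K \<in> lmeasurable"
    using cK by (rule lmeasurable_compact)
  have "measure lebesgue (A - K) < measure lebesgue A - s"
    using K(3,4) sA by (simp add: emeasure_eq_measure2 ennreal_less_iff)
  moreover have "measure lebesgue (A - K) = measure lebesgue A - measure lebesgue K"
    using Alm Klm K(2) by (simp add: measurable_measure_Diff fmeasurableD)
  ultimately have sK: "s < measure lebesgue K" by simp
  define F where "F a = measure lebesgue (K \<inter> {..a})" for a
  have lm: "K \<inter> {..a} \<in> lmeasurable" for a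
    using cK by (intro lmeasurable_compact compact_Int_closed) auto
  have mono: "F a \<le> F b" if "a \<le> b" for a b
    unfolding F_def using that lm by (intro measure_mono_fmeasurable) (auto simp: fmeasurableD)
  have lip: "F b \<le> F a + (b - a)" if "a \<le> b" for a b
  proof -
    have "F b \<le> measure lebesgue ((K \<inter> {..a}) \<union> {a..b})"
      unfolding F_def using lm by (intro measure_mono_fmeasurable) (auto simp: fmeasurableD)
    also have "\<dots> \<le> measure lebesgue (K \<inter> {..a}) + measure lebesgue {a..b}"
      using lm by (intro measure_Un_le) (auto simp: fmeasurableD)
    finally show ?thesis
      using that by (simp add: F_def)
  qed
  have "\<bar>F b - F a\<bar> \<le> \<bar>b - a\<bar>" for a b
    using lip[of a b] lip[of b a] mono[of a b] mono[of b a] by linarith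
  then have "1-lipschitz_on UNIV F"
    by (intro lipschitz_onI) (auto simp: dist_real_def abs_minus_commute)
  then have "continuous_on UNIV F"
    by (rule lipschitz_on_continuous_on)
  then have cont: "isCont F x" for x
    by (simp add: continuous_on_eq_continuous_at)
  obtain r where r: "\<And>x. x \<in> K \<Longrightarrow> \<bar>x\<bar> \<le> r"
    using compact_imp_bounded[OF cK] by (auto simp: bounded_iff)
  have "K \<inter> {..- \<bar>r\<bar> - 1} = {}" "K \<inter> {..\<bar>r\<bar>} = K"
    using r by force+
  then have ends: "F (- \<bar>r\<bar> - 1) = 0" "F \<bar>r\<bar> = measure lebesgue K"
    by (simp_all add: F_def)
  have quantile: "\<exists>a\<in>K. F a = v" if v: "0 < v" "v \<le> measure lebesgue K" for v
  proof -
    have "\<exists>b\<ge>- \<bar>r\<bar> - 1. b \<le> \<bar>r\<bar> \<and> F b = v"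
      using v ends cont by (intro IVT) auto
    then obtain b where b: "F b = v" by blast
    \<comment> \<open>The point \<open>b\<close> need not lie in \<open>K\<close>. Moving it down to
      the last point of \<open>K\<close> below it leaves \<open>F\<close> unchanged; such a point
      exists because \<open>v > 0\<close>.\<close>
    have "K \<inter> {..b} \<noteq> {}"
      using b v by (auto simp: F_def)
    then obtain a where a: "a \<in> K \<inter> {..b}" "\<And>x. x \<in> K \<inter> {..b} \<Longrightarrow> x \<le> a"
      using compact_attains_sup[of "K \<inter> {..b}"] cK by (auto simp: compact_Int_closed)
    then have "K \<inter> {..a} = K \<inter> {..b}" by force
    then have "F a = v" using b by (simp add: F_def)
    with a(1) show ?thesis by blast
  qed
  \<comment> \<open>The shift places all levels \<open>u + d\<close> in
    \<open>(0, measure lebesgue K]\<close>, where \<open>quantile\<close> applies; without it,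
    \<open>u = 0\<close> would give level 0.\<close>
  define d where "d = measure lebesgue K - s"
  have "\<forall>u\<in>{0..s}. \<exists>a. a \<in> K \<and> F a = u + d"
  proof
    fix u assume "u \<in> {0..s}"
    then show "\<exists>a. a \<in> K \<and> F a = u + d"
      using quantile[of "u + d"] sK by (auto simp: d_def)
  qed
  then obtain f where f: "\<And>u. u \<in> {0..s} \<Longrightarrow> f u \<in> K \<and> F (f u) = u + d"
    by metis
  show thesis
  proof
    show "f u \<in> A" if "u \<in> {0..s}" for u
      using f that K(2) by blast
    show "v - u \<le> f v - f u" if "u \<in> {0..s}" "v \<in> {0..s}" "u < v" for u v
      \<comment> \<open>By \<open>mono\<close>, \<open>f v \<le> f u\<close> would contradict
        \<open>u < v\<close>; hence \<open>f u < f v\<close>, and \<open>lip\<close> gives the slope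
        bound.\<close>
      using f[OF that(1)] f[OF that(2)] that(3) mono[of "f v" "f u"] lip[of "f u" "f v"]
      by linarith
  qed
qed

section \<open>Counting with binomial coefficients\<close>

text \<open>Being linear in the binomial coefficient, this bound can be integrated directly and replaces
  the appeal to Jensen's inequality in the usual double counting.\<close>

lemma le_binomial_linearized:
  fixes l :: real
  assumes "0 < t" "0 < l"
  shows "real m \<le> t * (1 + l) + t * l / l ^ t * real (m choose t)"
\<comment> \<open>Beyond this threshold \<open>m\<close> exceeds both \<open>t\<close>, as the lower
  bound on the binomial coefficient requires, and \<open>t * l\<close>, so that
  \<open>m / (t * l)\<close> only grows when raised to the power \<open>t\<close>.\<close>
proof (cases "real m \<le> t * (1 + l)")
  case True
  then show ?thesis
    using assms by (simp add: add_increasing2)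
next
  case False
  moreover have "0 < real t" "0 < t * l" using assms by auto
  ultimately have tm: "real t < real m" "t * l < real m"
    by (simp_all add: distrib_left)
  have "1 \<le> m / (t * l)"
    using tm assms by (simp add: field_simps)
  then have "m / (t * l) \<le> (m / (t * l)) ^ t"
    using assms by (simp add: self_le_power)
  also have "\<dots> = (m / t) ^ t / l ^ t"
    by (simp add: power_divide power_mult_distrib)
  also have "\<dots> \<le> real (m choose t) / l ^ t"
    using tm assms by (intro divide_right_mono binomial_ge_n_over_k_pow_k) auto
  finally have "m \<le> t * l * (real (m choose t) / l ^ t)"
    using assms by (simp add: field_simps)
  moreover have "0 \<le> t * (1 + l)"
    using assms by simp
  ultimately show ?thesis by simp
qed

text \<open>The linearized bound is integrated over \<open>x\<close>, with \<open>m\<close> the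
  number of sets \<open>A i\<close> containing \<open>x\<close>; then \<open>m choose t\<close>
  counts the \<open>t\<close>-fold intersections containing \<open>x\<close>. The constant term is
  charged only on \<open>B\<close>.\<close>

lemma sum_emeasure_le_of_Inter:
  fixes A :: "'i \<Rightarrow> 'a set" and l :: real
  assumes I: "finite I" and A: "\<And>i. i \<in> I \<Longrightarrow> A i \<in> sets M" "\<And>i. i \<in> I \<Longrightarrow> A i \<subseteq> B"
    and B: "B \<in> sets M" and t: "0 < t" and l: "0 < l"
    and Int: "\<And>K. K \<subseteq> I \<Longrightarrow> card K = t \<Longrightarrow> emeasure M (\<Inter>i\<in>K. A i) \<le> s"
  shows "(\<Sum>i\<in>I. emeasure M (A i))
    \<le> ennreal (t * (1 + l)) * emeasure M B + ennreal (t * l / l ^ t) * (of_nat (card I ^ t) * s)"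
proof -
  define KK where "KK = {K. K \<subseteq> I \<and> card K = t}"
  have finKK: "finite KK"
    using I by (simp add: KK_def)
  have IntM: "(\<Inter>i\<in>K. A i) \<in> sets M" if "K \<in> KK" for K
  proof (rule sets.finite_INT)
    show "finite K" "K \<noteq> {}"
      using that t I by (auto simp: KK_def intro: finite_subset)
    show "A i \<in> sets M" if "i \<in> K" for i
      using that \<open>K \<in> KK\<close> A by (auto simp: KK_def)
  qed
  have pw: "(\<Sum>i\<in>I. indicator (A i) x :: ennreal)
      \<le> ennreal (t * (1 + l)) * indicator B x
        + ennreal (t * l / l ^ t) * (\<Sum>K\<in>KK. indicator (\<Inter>i\<in>K. A i) x)" (is "?L \<le> ?R") for x
  proof -
    define J where "J = {i\<in>I. x \<in> A i}"
    have finJ: "finite J" using I by (simp add: J_def)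
    have L: "?L = ennreal (card J)"
      using I by (simp add: J_def indicator_def sum.If_cases Int_def ennreal_of_nat_eq_real_of_nat)
    have "(\<Sum>K\<in>KK. indicator (\<Inter>i\<in>K. A i) x :: ennreal) = of_nat (card {K\<in>KK. x \<in> (\<Inter>i\<in>K. A i)})"
      using finKK by (simp add: indicator_def sum.If_cases Int_def)
    also have "{K\<in>KK. x \<in> (\<Inter>i\<in>K. A i)} = {K. K \<subseteq> J \<and> card K = t}"
      by (auto simp: KK_def J_def)
    also have "card \<dots> = card J choose t"
      using finJ by (rule n_subsets)
    finally have S: "(\<Sum>K\<in>KK. indicator (\<Inter>i\<in>K. A i) x :: ennreal) = ennreal (real (card J choose t))"
      by (simp add: ennreal_of_nat_eq_real_of_nat)
    show ?thesis
    \<comment> \<open>Outside \<open>B\<close> the constant term vanishes, but there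
      \<open>J\<close> is empty and the left side is 0.\<close>
    proof (cases "J = {}")
      case True
      then show ?thesis unfolding L by simp
    next
      case False
      then have "x \<in> B" using A(2) by (auto simp: J_def)
      then have "?R = ennreal (t * (1 + l) + t * l / l ^ t * real (card J choose t))"
        unfolding S using l
        by (simp add: ennreal_plus[symmetric] ennreal_mult[symmetric] del: ennreal_plus)
      then show ?thesis
        unfolding L using le_binomial_linearized[OF t l, of "card J"] by (simp add: ennreal_leI)
    qed
  qed
  have "(\<Sum>i\<in>I. emeasure M (A i)) = (\<integral>\<^sup>+x. (\<Sum>i\<in>I. indicator (A i) x) \<partial>M)"
    using A by (subst nn_integral_sum) auto
  also have "\<dots> \<le> (\<integral>\<^sup>+x. ennreal (t * (1 + l)) * indicator B x
        + ennreal (t * l / l ^ t) * (\<Sum>K\<in>KK. indicator (\<Inter>i\<in>K. A i) x) \<partial>M)"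
    by (intro nn_integral_mono pw)
  also have "\<dots> = ennreal (t * (1 + l)) * emeasure M B
      + ennreal (t * l / l ^ t) * (\<Sum>K\<in>KK. emeasure M (\<Inter>i\<in>K. A i))"
    using B IntM by (subst nn_integral_add) (auto simp: nn_integral_cmult nn_integral_sum)
  also have "(\<Sum>K\<in>KK. emeasure M (\<Inter>i\<in>K. A i)) \<le> of_nat (card KK) * s"
    using Int by (intro sum_bounded_above) (auto simp: KK_def)
  also have "card KK = card I choose t"
    unfolding KK_def using I by (rule n_subsets)
  also have "card I choose t \<le> card I ^ t"
    by (cases "t \<le> card I") (auto simp: binomial_le_pow binomial_eq_0)
  finally show ?thesis
    by (simp add: add_left_mono mult_left_mono mult_right_mono)
qed

section \<open>Slices of a pattern-free set\<close>

lemma open_slice: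
  assumes "open S"
  shows "open {x. (x, y) \<in> S}"
  using open_vimage[OF assms, of "\<lambda>x. (x, y)"] by (simp add: vimage_def continuous_intros)

lemma strict_mono_on_nat_diff_le:
  fixes h :: "nat \<Rightarrow> nat"
  assumes "strict_mono_on {..<t} h" "i \<le> j" "j < t"
  shows "h i + (j - i) \<le> h j"
  using assms(2,3)
proof (induction j rule: dec_induct)
  case base
  then show ?case by simp
next
  case (step m)
  then have "h m < h (Suc m)"
    using assms(1) by (auto simp: strict_mono_on_def)
  with step show ?case by simp
qed

text \<open>Otherwise an expanding map into the common part of the slices, together with the
  increasing enumeration of their heights, would embed the pattern in \<open>S\<close>.\<close>

lemma plane_free_Inter_slices_le:
  assumes c: "0 < c" and s: "0 \<le> s" and S: "open S" "bounded S"
    and free: "plane_free (segment_pattern s t c) S"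
    and K: "card K = t" and t: "0 < t"
  shows "emeasure lborel (\<Inter>k\<in>K. {x. (x, y + real k * c) \<in> S}) \<le> ennreal s"
proof (rule ccontr)
  define A where "A = (\<Inter>k\<in>K. {x. (x, y + real k * c) \<in> S})"
  assume "\<not> ?thesis"
  then have big: "ennreal s < emeasure lborel A" by (simp add: A_def)
  have finK: "finite K" and neK: "K \<noteq> {}"
    using K t by (auto intro: card_ge_0_finite)
  have oA: "open A"
    unfolding A_def using finK open_slice[OF S(1)] by blast
  have "A \<subseteq> fst ` S"
    using neK by (force simp: A_def)
  then have "bounded A"
    using S(2) bounded_fst bounded_subset by blast
  moreover have "A \<in> sets lborel"
    using oA by simp
  ultimately obtain f where f: "\<And>u. u \<in> {0..s} \<Longrightarrow> f u \<in> A"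
    "\<And>u v. u \<in> {0..s} \<Longrightarrow> v \<in> {0..s} \<Longrightarrow> u < v \<Longrightarrow> v - u \<le> f v - f u"
    using expanding_map_exists[of A s] s big by (auto simp: sets_completionI_sets)
  obtain h where h: "bij_betw h {..<t} K" "strict_mono_on {..<t} h"
    using ex_bij_betw_strict_mono_card[OF finK] K by metis
  \<comment> \<open>The index \<open>k\<close> is recovered from the height \<open>k * c\<close>;
    the pattern counts its rows from 1, while \<open>h\<close> enumerates \<open>K\<close> from
    0.\<close>
  define g where "g z = y + real (h (nat \<lfloor>z / c\<rfloor> - 1)) * c" for z
  have g: "g (real k * c) = y + real (h (k - 1)) * c" for k
    using c by (simp add: g_def)
  have inS: "(f u, g (real k * c)) \<in> S" if "u \<in> {0..s}" "k \<in> {1..t}" for u k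
  proof -
    have "h (k - 1) \<in> K"
      using that h(1) by (auto simp: bij_betw_def)
    then show ?thesis
      using f(1)[OF that(1)] by (auto simp: A_def g)
  qed
  have fst_P: "fst ` segment_pattern s t c = {0..s}"
    and snd_P: "snd ` segment_pattern s t c = (\<lambda>k. real k * c) ` {1..t}"
    using s t by (auto simp: segment_pattern_def)
  have "1 \<le> (g y0 - g y1) / (y0 - y1)"
    if P: "y0 \<in> snd ` segment_pattern s t c" "y1 \<in> snd ` segment_pattern s t c"
      and less: "y1 < y0" for y0 y1
  proof -
    obtain i j where ij: "i \<in> {1..t}" "j \<in> {1..t}" "y0 = real j * c" "y1 = real i * c"
      using P unfolding snd_P by auto
    with less c have "i < j" by simp
    \<comment> \<open>A strictly increasing integer sequence grows at least as fast as its index;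
      scaling by \<open>c\<close> turns this into slope at least 1.\<close>
    then have "h (i - 1) + (j - i) \<le> h (j - 1)"
      using strict_mono_on_nat_diff_le[OF h(2), of "i - 1" "j - 1"] ij by simp
    with \<open>i < j\<close> have "real j - real i \<le> real (h (j - 1)) - real (h (i - 1))"
      by linarith
    then have "(real j - real i) * c \<le> (real (h (j - 1)) - real (h (i - 1))) * c"
      using c by (intro mult_right_mono) auto
    then have "y0 - y1 \<le> g y0 - g y1"
      unfolding ij(3,4) g by (simp add: algebra_simps)
    with less show ?thesis by simp
  qed
  moreover have "f \<in> fst ` segment_pattern s t c \<rightarrow> fst ` S"
    unfolding fst_P using inS[of _ 1] t by force
  moreover have "g \<in> snd ` segment_pattern s t c \<rightarrow> snd ` S"
    unfolding snd_P using inS[of 0] s by force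
  moreover have "1 \<le> (f x0 - f x1) / (x0 - x1)"
    if "x0 \<in> fst ` segment_pattern s t c" "x1 \<in> fst ` segment_pattern s t c" "x1 < x0" for x0 x1
    using that f(2)[of x1 x0] unfolding fst_P by simp
  moreover have "\<forall>(x, z) \<in> segment_pattern s t c. (f x, g z) \<in> S"
    using inS by (auto simp: segment_pattern_def)
  ultimately have "plane_contains S (segment_pattern s t c)"
    unfolding plane_contains_def by blast
  with free show False by (simp add: plane_free_def)
qed

section \<open>Integration over one period of heights\<close>

text \<open>By Tonelli the area is the integral of the slice lengths. Cutting the heights into
  \<open>N\<close> intervals of length \<open>c\<close> and translating each to
  \<open>[0, c)\<close> leaves an integral of the periodized sum.\<close>

lemma emeasure_le_of_periodized_slices:
  fixes S :: "(real \<times> real) set"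
  assumes c: "0 < c" and S: "S \<in> sets borel" "S \<subseteq> UNIV \<times> {0..<real N * c}"
    and b: "\<And>y. (\<Sum>k<N. emeasure lborel {x. (x, y + real k * c) \<in> S}) \<le> b"
  shows "emeasure lborel S \<le> ennreal c * b"
proof -
  define g where "g y = emeasure lborel {x. (x, y) \<in> S}" for y
  have S': "S \<in> sets (lborel \<Otimes>\<^sub>M lborel)"
    using S(1) unfolding lborel_prod by simp
  have vim: "(\<lambda>x. (x, y)) -` S = {x. (x, y) \<in> S}" for y by auto
  have gm [measurable]: "g \<in> borel_measurable borel"
    using lborel_pair.measurable_emeasure_Pair2[OF S'] unfolding vim g_def by simp
  have "emeasure lborel S = emeasure (lborel \<Otimes>\<^sub>M lborel) S"
    by (simp add: lborel_prod)
  also have "\<dots> = (\<integral>\<^sup>+y. g y \<partial>lborel)"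
    using lborel_pair.emeasure_pair_measure_alt2[OF S'] unfolding vim g_def .
  also have "\<dots> \<le> (\<integral>\<^sup>+y. (\<Sum>k<N. g y * indicator {0..<c} (y - real k * c)) \<partial>lborel)"
  proof (rule nn_integral_mono)
    fix y
    show "g y \<le> (\<Sum>k<N. g y * indicator {0..<c} (y - real k * c))"
    proof (cases "y \<in> {0..<real N * c}")
      case False
      then have "{x. (x, y) \<in> S} = {}" using S(2) by auto
      then show ?thesis by (simp add: g_def)
    next
      case True
      define k where "k = nat \<lfloor>y / c\<rfloor>"
      have "0 \<le> y / c" using True c by simp
      then have k: "real k \<le> y / c" "y / c < real k + 1"
        unfolding k_def by linarith+
      moreover have "y / c < real N"
        using True c by (simp add: field_simps)
      ultimately have "k < N" by linarith
      have "y - real k * c \<in> {0..<c}"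
        using k c by (auto simp: field_simps)
      then have "g y = g y * indicator {0..<c} (y - real k * c)" by simp
      also have "\<dots> \<le> (\<Sum>k<N. g y * indicator {0..<c} (y - real k * c))"
        using \<open>k < N\<close> by (intro member_le_sum) auto
      finally show ?thesis .
    qed
  qed
  also have "\<dots> = (\<Sum>k<N. \<integral>\<^sup>+y. g y * indicator {0..<c} (y - real k * c) \<partial>lborel)"
    by (intro nn_integral_sum) measurable
  also have "\<dots> = (\<Sum>k<N. \<integral>\<^sup>+y. g (y + real k * c) * indicator {0..<c} y \<partial>lborel)"
  proof (rule sum.cong[OF refl])
    fix k
    show "(\<integral>\<^sup>+y. g y * indicator {0..<c} (y - real k * c) \<partial>lborel)
        = (\<integral>\<^sup>+y. g (y + real k * c) * indicator {0..<c} y \<partial>lborel)"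
      by (subst nn_integral_real_affine[where c = 1 and t = "real k * c"]) (auto simp: add.commute)
  qed
  also have "\<dots> = (\<integral>\<^sup>+y. (\<Sum>k<N. g (y + real k * c) * indicator {0..<c} y) \<partial>lborel)"
    by (intro nn_integral_sum[symmetric]) measurable
  also have "\<dots> \<le> (\<integral>\<^sup>+y. b * indicator {0..<c} y \<partial>lborel)"
    using b by (intro nn_integral_mono) (simp add: sum_distrib_right[symmetric] mult_right_mono g_def)
  also have "\<dots> = ennreal c * b"
    using c by (simp add: nn_integral_cmult mult.commute)
  finally show ?thesis .
qed

section \<open>The area bound and its asymptotics\<close>

lemma plane_free_emeasure_le:
  assumes c: "0 < c" and s: "0 < s" and t: "0 < t" and n: "0 < n" "c \<le> n"
    and S: "open S" "S \<subseteq> {0..n} \<times> {0..n}"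
    and free: "plane_free (segment_pattern s t c) S"
  shows "emeasure lborel S \<le> ennreal (c * t * n + 4 * real t * (s powr (1 / t) * n powr (2 - 1 / t)))"
proof -
  \<comment> \<open>The added 1 gives \<open>n < N * c\<close>, so the half-open strip covers
    \<open>S\<close>; since \<open>n / c \<ge> 1\<close>, it still leaves
    \<open>N \<le> 2 * n / c\<close>.\<close>
  define N where "N = nat \<lfloor>n / c\<rfloor> + 1"
  \<comment> \<open>This value of \<open>l\<close> balances the two terms of \<open>sum_emeasure_le_of_Inter\<close>.\<close>
  define l where "l = 2 * n / c * (s / n) powr (1 / t)"
  have l: "0 < l" using c s n by (simp add: l_def)
  have "((s / n) powr (1 / t)) ^ t = s / n"
    using s n t by (simp add: powr_realpow[symmetric] powr_powr)
  then have lt: "l ^ t = (2 * n / c) ^ t * (s / n)"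
    unfolding l_def by (simp only: power_mult_distrib)
  have "1 \<le> n / c" using n c by simp
  then have N: "n / c < real N" "real N \<le> 2 * n / c"
    unfolding N_def by linarith+
  have "n < real N * c" using N(1) c by (simp add: field_simps)
  have "bounded S"
    using bounded_Times[OF bounded_closed_interval bounded_closed_interval] S(2)
    by (rule bounded_subset)
  have "(\<Sum>k<N. emeasure lborel {x. (x, y + real k * c) \<in> S})
      \<le> ennreal (t * n + 2 * t * l * n)" for y
  proof -
    have "open {x. (x, y + real k * c) \<in> S}" for k
      using S(1) by (rule open_slice)
    then have "(\<Sum>k<N. emeasure lborel {x. (x, y + real k * c) \<in> S})
      \<le> ennreal (t * (1 + l)) * emeasure lborel {0..n}
        + ennreal (t * l / l ^ t) * (of_nat (card {..<N} ^ t) * ennreal s)"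
      using S t l plane_free_Inter_slices_le[OF c _ S(1) \<open>bounded S\<close> free] s
      by (intro sum_emeasure_le_of_Inter) auto
    also have "\<dots> = ennreal (t * (1 + l) * n + t * l / l ^ t * (real N ^ t * s))"
      using l n s
      by (simp add: ennreal_of_nat_eq_real_of_nat ennreal_plus[symmetric] ennreal_mult[symmetric]
          del: ennreal_plus)
    also have "\<dots> \<le> ennreal (t * n + 2 * t * l * n)"
    proof (rule ennreal_leI)
      \<comment> \<open>With this \<open>l\<close>, \<open>N ^ t * s\<close> is at most
        \<open>l ^ t * n\<close>, so the intersection term is at most \<open>t * l * n\<close>,
        matching the part of the first term that is linear in \<open>l\<close>.\<close>
      have "real N ^ t * s \<le> (2 * n / c) ^ t * s"
        using N s by (intro mult_right_mono power_mono) auto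
      also have "\<dots> = l ^ t * n"
        using n by (simp add: lt)
      finally have "t * l / l ^ t * (real N ^ t * s) \<le> t * l / l ^ t * (l ^ t * n)"
        using l by (intro mult_left_mono) auto
      also have "\<dots> = t * l * n" using l by simp
      finally show "t * (1 + l) * n + t * l / l ^ t * (real N ^ t * s) \<le> t * n + 2 * t * l * n"
        by (simp add: algebra_simps)
    qed
    finally show ?thesis .
  qed
  then have "emeasure lborel S \<le> ennreal c * ennreal (t * n + 2 * t * l * n)"
    using S \<open>n < real N * c\<close> by (intro emeasure_le_of_periodized_slices[where N = N] c) auto
  also have "\<dots> = ennreal (c * (t * n + 2 * t * l * n))"
    using c by (simp add: ennreal_mult')
  also have "c * (t * n + 2 * t * l * n) = c * t * n + 4 * real t * (n\<^sup>2 * (s / n) powr (1 / t))"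
    using c by (simp add: l_def field_simps power2_eq_square)
  also have "n\<^sup>2 * (s / n) powr (1 / t) = s powr (1 / t) * n powr (2 - 1 / t)"
    using n s by (simp add: powr_divide powr_diff)
  finally show ?thesis .
qed

theorem theorem4p8:
  fixes c :: real and t :: nat
  assumes "c > 0" and "t \<ge> 2"
  shows "\<exists>C>0. \<forall>s>0. \<forall>\<^sub>F n in at_top.
           opx n (segment_pattern s t c)
             \<le> ennreal (C * (s powr (1 / real t) * n powr (2 - 1 / real t)))"
proof (intro exI[of _ "4 * real t + 1"] conjI allI impI)
  \<comment> \<open>The summand \<open>4 * t\<close> comes from the main term of the area bound; the
    extra 1 absorbs the term \<open>c * t * n\<close>.\<close>
  show "0 < 4 * real t + 1" by simp
  fix s :: real
  assume s: "0 < s"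
  \<comment> \<open>\<open>e\<close> is the gap between the exponents \<open>2 - 1 / t\<close> and
    1, positive as \<open>t \<ge> 2\<close>. The linear term is absorbed as soon as
    \<open>n powr e \<ge> D\<close>.\<close>
  define e where "e = 1 - 1 / real t"
  define D where "D = c * t / s powr (1 / t)"
  have e: "0 < e" using \<open>t \<ge> 2\<close> by (simp add: e_def)
  have D: "0 < D" using assms s by (simp add: D_def)
  show "\<forall>\<^sub>F n in at_top. opx n (segment_pattern s t c)
      \<le> ennreal ((4 * real t + 1) * (s powr (1 / real t) * n powr (2 - 1 / real t)))"
    using eventually_ge_at_top[of "D powr (1 / e)"] eventually_ge_at_top[of c]
  proof eventually_elim
    case (elim n)
    with \<open>c > 0\<close> have n: "0 < n" by simp
    have "(D powr (1 / e)) powr e \<le> n powr e"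
      using elim(1) e by (intro powr_mono2) auto
    then have "D \<le> n powr (1 - 1 / t)"
      using e D by (simp add: powr_powr) (simp add: e_def)
    then have "c * t \<le> s powr (1 / t) * n powr (1 - 1 / t)"
      using s by (simp add: D_def field_simps)
    then have "c * t * n \<le> s powr (1 / t) * n powr (1 - 1 / t) * n"
      using n by (intro mult_right_mono) auto
    also have "\<dots> = s powr (1 / t) * n powr (2 - 1 / t)"
      using n by (simp add: powr_mult_base[symmetric] powr_diff power2_eq_square)
    finally have "c * t * n + 4 * real t * (s powr (1 / t) * n powr (2 - 1 / t))
        \<le> (4 * real t + 1) * (s powr (1 / real t) * n powr (2 - 1 / real t))"
      by (simp add: algebra_simps)
    then have "emeasure lebesgue S
        \<le> ennreal ((4 * real t + 1) * (s powr (1 / real t) * n powr (2 - 1 / real t)))"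
      if "open S" "S \<subseteq> {0..n} \<times> {0..n}" "plane_free (segment_pattern s t c) S" for S
      using plane_free_emeasure_le[OF \<open>c > 0\<close> s _ n elim(2) that] \<open>t \<ge> 2\<close> that(1)
      by (auto intro: order_trans ennreal_leI)
    then show ?case
      unfolding opx_def by (intro SUP_least) auto
  qed
qed

end
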